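(* Let $n\ge2$ and let $X_1,\ldots,X_n$ be a discrete-time Markov chain of random functions on a probability scheme $(\Omega,\mathrm{pr})$. Then the reverse sequence $X_n,\ldots,X_1$ is again a discrete-time Markov chain.
   Context: A (probability) scheme is a finite set $\Omega$ with a function $\mathrm{pr}\colon\Omega\to(0,\infty)$ such that $\sum_{\omega}\mathrm{pr}(\omega)=1$. A random function is a function (with values in any set) defined on a scheme. A sequence $X_1,\ldots,X_n$ ($n\ge2$) of random functions on $(\Omega,\mathrm{pr})$ is a (discrete-time) Markov chain if for each $2\le i\le n$ and each $\langle x_1,\ldots,x_i\rangle$ in the range of $\langle X_1,\ldots,X_i\rangle$, $\Pr(X_i=x_i|X_1=x_1,\ldots,X_{i-1}=x_{i-1})=\Pr(X_i=x_i|X_{i-1}=x_{i-1})$. (No time-homogeneity is assumed.) *)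

theory Defs
  imports "HOL-Probability.Probability"
begin

definition prob_scheme :: "'a set \<Rightarrow> ('a \<Rightarrow> real) \<Rightarrow> bool" where
  "prob_scheme \<Omega> pr \<longleftrightarrow> finite \<Omega> \<and> (\<forall>\<omega>\<in>\<Omega>. 0 < pr \<omega>) \<and> (\<Sum>\<omega>\<in>\<Omega>. pr \<omega>) = 1"

text \<open>
  The measure on the subsets of the scheme giving an event the total weight of its points;
  it depends only on the values of the weight function on the scheme itself.
\<close>

definition scheme_measure :: "'a set \<Rightarrow> ('a \<Rightarrow> real) \<Rightarrow> 'a measure" where
  "scheme_measure \<Omega> pr = point_measure \<Omega> (\<lambda>\<omega>. ennreal (pr \<omega>))"

text \<open>
  A sequence of random functions is indexed by \<open>{1..n}\<close>; values of \<open>X\<close> at other indices, or at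
  points outside \<open>\<Omega>\<close>, play no role. The arbitrary type of values stands for the union of the
  sets in which the individual random functions take their values. The tuple in the range of
  the first \<open>i\<close> random functions is given by the values of \<open>x\<close> on \<open>{1..i}\<close>.
\<close>

definition markov_chain ::
    "'a set \<Rightarrow> ('a \<Rightarrow> real) \<Rightarrow> nat \<Rightarrow> (nat \<Rightarrow> 'a \<Rightarrow> 'b) \<Rightarrow> bool" where
  "markov_chain \<Omega> pr n X \<longleftrightarrow> 2 \<le> n \<and>
     (\<forall>i\<in>{2..n}. \<forall>x :: nat \<Rightarrow> 'b.
        (\<exists>\<omega>\<in>\<Omega>. \<forall>j\<in>{1..i}. X j \<omega> = x j) \<longrightarrow>
        cond_prob (scheme_measure \<Omega> pr) (\<lambda>\<omega>. X i \<omega> = x i) (\<lambda>\<omega>. \<forall>j\<in>{1..i - 1}. X j \<omega> = x j) =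
        cond_prob (scheme_measure \<Omega> pr) (\<lambda>\<omega>. X i \<omega> = x i) (\<lambda>\<omega>. X (i - 1) \<omega> = x (i - 1)))"

end

theory Submission
  imports Defs
begin

text \<open>
  Writing \<open>p(a..b)\<close> for the probability that \<open>X\<^sub>a, \<dots>, X\<^sub>b\<close> take prescribed values,
  the Markov property says \<open>p(1..k+1) p(k) = p(k,k+1) p(1..k)\<close>. Summing out the first values gives
  \<open>p(a..k+1) p(k) = p(k,k+1) p(a..k)\<close> for all \<open>a \<le> k\<close>, and induction on \<open>k\<close> turns this into
  \<open>p(m..k) p(m+1) = p(m,m+1) p(m+1..k)\<close>, which for \<open>k = n\<close> is the Markov property of the
  reversed sequence.
\<close>

text \<open>Plain finite sums of reals let the conditional probabilities be handled as quotients of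
  reals, without measure theory.\<close>

definition scheme_prob :: "'a set \<Rightarrow> ('a \<Rightarrow> real) \<Rightarrow> ('a \<Rightarrow> bool) \<Rightarrow> real" where
  "scheme_prob \<Omega> pr Q = (\<Sum>\<omega> | \<omega> \<in> \<Omega> \<and> Q \<omega>. pr \<omega>)"

context
  fixes \<Omega> :: "'a set" and pr :: "'a \<Rightarrow> real"
  assumes scheme: "prob_scheme \<Omega> pr"
begin

lemma scheme_prob_nonneg: "0 \<le> scheme_prob \<Omega> pr Q"
  using scheme unfolding scheme_prob_def prob_scheme_def by (intro sum_nonneg) (auto intro: less_imp_le)

text \<open>All weights are strictly positive, so only the empty event is null; membership of a
  tuple in the range thus becomes a nonzero denominator.\<close>

lemma scheme_prob_pos_iff: "0 < scheme_prob \<Omega> pr Q \<longleftrightarrow> (\<exists>\<omega>\<in>\<Omega>. Q \<omega>)"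
proof
  assume "0 < scheme_prob \<Omega> pr Q"
  then show "\<exists>\<omega>\<in>\<Omega>. Q \<omega>"
    unfolding scheme_prob_def by (metis (no_types, lifting) less_irrefl mem_Collect_eq sum.neutral)
next
  assume "\<exists>\<omega>\<in>\<Omega>. Q \<omega>"
  then show "0 < scheme_prob \<Omega> pr Q"
    using scheme unfolding scheme_prob_def prob_scheme_def by (intro sum_pos) auto
qed

lemma scheme_prob_eq_0_iff: "scheme_prob \<Omega> pr Q = 0 \<longleftrightarrow> (\<forall>\<omega>\<in>\<Omega>. \<not> Q \<omega>)"
  using scheme_prob_pos_iff[of Q] scheme_prob_nonneg[of Q] by fastforce

text \<open>Total probability: grouping the points by the value of \<open>f\<close> is the device
  for summing out one variable.\<close>

lemma scheme_prob_partition: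
  "(\<Sum>v\<in>f ` \<Omega>. scheme_prob \<Omega> pr (\<lambda>\<omega>. Q \<omega> \<and> f \<omega> = v)) = scheme_prob \<Omega> pr Q"
proof -
  have fin: "finite \<Omega>"
    using scheme by (simp add: prob_scheme_def)
  have "(\<Sum>v\<in>f ` \<Omega>. sum pr {\<omega> \<in> {\<omega> \<in> \<Omega>. Q \<omega>}. f \<omega> = v}) = sum pr {\<omega> \<in> \<Omega>. Q \<omega>}"
    using fin by (intro sum.group) auto
  then show ?thesis
    by (simp add: scheme_prob_def conj_assoc)
qed

lemma cond_prob_scheme_measure:
  "cond_prob (scheme_measure \<Omega> pr) Q R =
     scheme_prob \<Omega> pr (\<lambda>\<omega>. Q \<omega> \<and> R \<omega>) / scheme_prob \<Omega> pr R"
proof -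
  have nonneg: "0 \<le> pr \<omega>" if "\<omega> \<in> \<Omega>" for \<omega>
    using scheme that by (simp add: prob_scheme_def less_imp_le)
  have "measure (scheme_measure \<Omega> pr) {\<omega> \<in> \<Omega>. P \<omega>} = scheme_prob \<Omega> pr P" for P
  proof -
    have "emeasure (scheme_measure \<Omega> pr) {\<omega> \<in> \<Omega>. P \<omega>} = (\<Sum>\<omega> | \<omega> \<in> \<Omega> \<and> P \<omega>. ennreal (pr \<omega>))"
      unfolding scheme_measure_def
      using scheme by (intro emeasure_point_measure_finite) (auto simp: prob_scheme_def)
    also have "\<dots> = ennreal (scheme_prob \<Omega> pr P)"
      unfolding scheme_prob_def by (intro sum_ennreal) (simp add: nonneg)
    finally show ?thesis
      by (simp add: measure_def scheme_prob_nonneg)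
  qed
  moreover have "space (scheme_measure \<Omega> pr) = \<Omega>"
    by (simp add: scheme_measure_def space_point_measure)
  ultimately show ?thesis
    by (simp add: cond_prob_def)
qed

text \<open>
  If the law of \<open>f\<close> given \<open>Q\<close> agrees with its law given \<open>R\<close> at all values possible under \<open>Q\<close>,
  it agrees everywhere, as the former values already exhaust the total mass. This is needed
  because the Markov property is only assumed on the range of the chain.
\<close>

lemma scheme_prob_mult_eq_extend:
  assumes eq: "\<And>v. \<exists>\<omega>\<in>\<Omega>. Q \<omega> \<and> f \<omega> = v \<Longrightarrow>
      scheme_prob \<Omega> pr (\<lambda>\<omega>. Q \<omega> \<and> f \<omega> = v) * scheme_prob \<Omega> pr R =
      scheme_prob \<Omega> pr (\<lambda>\<omega>. R \<omega> \<and> f \<omega> = v) * scheme_prob \<Omega> pr Q"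
  shows "scheme_prob \<Omega> pr (\<lambda>\<omega>. Q \<omega> \<and> f \<omega> = v) * scheme_prob \<Omega> pr R =
      scheme_prob \<Omega> pr (\<lambda>\<omega>. R \<omega> \<and> f \<omega> = v) * scheme_prob \<Omega> pr Q"
proof -
  let ?p = "\<lambda>Q v. scheme_prob \<Omega> pr (\<lambda>\<omega>. Q \<omega> \<and> f \<omega> = v)"
  let ?d = "\<lambda>v. ?p R v * scheme_prob \<Omega> pr Q - ?p Q v * scheme_prob \<Omega> pr R"
  have fin: "finite (f ` \<Omega>)"
    using scheme by (simp add: prob_scheme_def)
  have "?d v \<ge> 0" for v
  proof (cases "\<exists>\<omega>\<in>\<Omega>. Q \<omega> \<and> f \<omega> = v")
    case True
    then show ?thesis using eq by simp
  next
    case False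
    then have "?p Q v = 0" by (subst scheme_prob_eq_0_iff) blast
    then show ?thesis by (simp add: scheme_prob_nonneg)
  qed
  \<comment> \<open>By total probability both families of products sum to the product of the
    probabilities of \<open>R\<close> and \<open>Q\<close>, so the nonnegative differences must all
    vanish.\<close>
  moreover have "(\<Sum>v\<in>f ` \<Omega>. ?d v) = 0"
    by (simp add: sum_subtractf flip: sum_distrib_right) (simp add: scheme_prob_partition)
  ultimately have d0: "?d v = 0" if "v \<in> f ` \<Omega>" for v
    using sum_nonneg_eq_0_iff[OF fin, of ?d] that by blast
  show ?thesis
  proof (cases "v \<in> f ` \<Omega>")
    case True
    then show ?thesis using d0 by fastforce
  next
    case False
    then have "?p Q v = 0" "?p R v = 0" by (subst scheme_prob_eq_0_iff; blast)+
    then show ?thesis by simp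
  qed
qed

text \<open>Cross-multiplication removes the denominators, so the Markov property can be stated for
  every \<open>x\<close>, also outside the range of the chain; this unrestricted form is what can
  later be summed over the values of a variable.\<close>

lemma markov_chain_mult:
  assumes "markov_chain \<Omega> pr n X" and "1 \<le> k" and "k < n"
  shows "scheme_prob \<Omega> pr (\<lambda>\<omega>. \<forall>j\<in>{1..Suc k}. X j \<omega> = x j) *
           scheme_prob \<Omega> pr (\<lambda>\<omega>. X k \<omega> = x k) =
         scheme_prob \<Omega> pr (\<lambda>\<omega>. X k \<omega> = x k \<and> X (Suc k) \<omega> = x (Suc k)) *
           scheme_prob \<Omega> pr (\<lambda>\<omega>. \<forall>j\<in>{1..k}. X j \<omega> = x j)"
proof -
  let ?Q = "\<lambda>\<omega>. \<forall>j\<in>{1..k}. X j \<omega> = x j"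
  let ?R = "\<lambda>\<omega>. X k \<omega> = x k"
  have eq: "scheme_prob \<Omega> pr (\<lambda>\<omega>. ?Q \<omega> \<and> X (Suc k) \<omega> = v) * scheme_prob \<Omega> pr ?R =
      scheme_prob \<Omega> pr (\<lambda>\<omega>. ?R \<omega> \<and> X (Suc k) \<omega> = v) * scheme_prob \<Omega> pr ?Q"
    if ex: "\<exists>\<omega>\<in>\<Omega>. ?Q \<omega> \<and> X (Suc k) \<omega> = v" for v
  proof -
    \<comment> \<open>Changing only the last entry to a possible value \<open>v\<close> gives a
      tuple in the range, to which the definition of a Markov chain applies.\<close>
    let ?y = "x(Suc k := v)"
    have "\<exists>\<omega>\<in>\<Omega>. \<forall>j\<in>{1..Suc k}. X j \<omega> = ?y j"
      using ex by (fastforce simp: atLeastAtMostSuc_conv)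
    moreover have "Suc k \<in> {2..n}"
      using assms by simp
    ultimately have
      "cond_prob (scheme_measure \<Omega> pr) (\<lambda>\<omega>. X (Suc k) \<omega> = ?y (Suc k)) (\<lambda>\<omega>. \<forall>j\<in>{1..Suc k - 1}. X j \<omega> = ?y j) =
       cond_prob (scheme_measure \<Omega> pr) (\<lambda>\<omega>. X (Suc k) \<omega> = ?y (Suc k)) (\<lambda>\<omega>. X (Suc k - 1) \<omega> = ?y (Suc k - 1))"
      using assms(1) unfolding markov_chain_def by blast
    moreover have "(\<forall>j\<in>{1..k}. X j \<omega> = ?y j) \<longleftrightarrow> ?Q \<omega>" for \<omega>
      by auto
    ultimately have
      "cond_prob (scheme_measure \<Omega> pr) (\<lambda>\<omega>. X (Suc k) \<omega> = v) ?Q =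
       cond_prob (scheme_measure \<Omega> pr) (\<lambda>\<omega>. X (Suc k) \<omega> = v) ?R"
      by simp
    moreover have "0 < scheme_prob \<Omega> pr ?Q" "0 < scheme_prob \<Omega> pr ?R"
      unfolding scheme_prob_pos_iff using ex \<open>1 \<le> k\<close> by auto
    ultimately show ?thesis
      by (simp add: cond_prob_scheme_measure frac_eq_eq conj_commute)
  qed
  have "scheme_prob \<Omega> pr (\<lambda>\<omega>. ?Q \<omega> \<and> X (Suc k) \<omega> = x (Suc k)) * scheme_prob \<Omega> pr ?R =
      scheme_prob \<Omega> pr (\<lambda>\<omega>. ?R \<omega> \<and> X (Suc k) \<omega> = x (Suc k)) * scheme_prob \<Omega> pr ?Q"
    by (rule scheme_prob_mult_eq_extend[where f = "X (Suc k)"]) (rule eq)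
  then show ?thesis
    by (simp add: atLeastAtMostSuc_conv conj_commute)
qed

text \<open>The start \<open>a\<close> moves up from 1, one variable being summed out at a time. The
  values \<open>x\<close> stay arbitrary in the induction because the entry at \<open>a\<close> has
  to run over all values of \<open>X a\<close>.\<close>

lemma markov_chain_mult_from:
  assumes "markov_chain \<Omega> pr n X" and "1 \<le> a" and "a \<le> k" and "k < n"
  shows "scheme_prob \<Omega> pr (\<lambda>\<omega>. \<forall>j\<in>{a..Suc k}. X j \<omega> = x j) *
           scheme_prob \<Omega> pr (\<lambda>\<omega>. X k \<omega> = x k) =
         scheme_prob \<Omega> pr (\<lambda>\<omega>. X k \<omega> = x k \<and> X (Suc k) \<omega> = x (Suc k)) *
           scheme_prob \<Omega> pr (\<lambda>\<omega>. \<forall>j\<in>{a..k}. X j \<omega> = x j)"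
  using assms(2,3)
proof (induction a arbitrary: x rule: dec_induct)
  case base
  then show ?case
    using markov_chain_mult[OF assms(1) _ assms(4)] by simp
next
  case (step a)
  have split: "(\<forall>j\<in>{a..b}. X j \<omega> = (x(a := v)) j) \<longleftrightarrow> (\<forall>j\<in>{Suc a..b}. X j \<omega> = x j) \<and> X a \<omega> = v"
    if "a \<le> b" for b v \<omega>
    unfolding atLeastAtMost_insertL[OF that, symmetric] by auto
  have eq: "scheme_prob \<Omega> pr (\<lambda>\<omega>. (\<forall>j\<in>{Suc a..Suc k}. X j \<omega> = x j) \<and> X a \<omega> = v) *
      scheme_prob \<Omega> pr (\<lambda>\<omega>. X k \<omega> = x k) =
    scheme_prob \<Omega> pr (\<lambda>\<omega>. X k \<omega> = x k \<and> X (Suc k) \<omega> = x (Suc k)) *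
      scheme_prob \<Omega> pr (\<lambda>\<omega>. (\<forall>j\<in>{Suc a..k}. X j \<omega> = x j) \<and> X a \<omega> = v)" for v
    using step.IH[of "x(a := v)"] step.prems by (simp only: split) simp
  \<comment> \<open>Only the two long events involve \<open>X a\<close>, since \<open>a < k\<close>;
    the other factors come out of the sum over its values.\<close>
  show ?case
    unfolding scheme_prob_partition[where f = "X a" and Q = "\<lambda>\<omega>. \<forall>j\<in>{Suc a..Suc k}. X j \<omega> = x j", symmetric]
      scheme_prob_partition[where f = "X a" and Q = "\<lambda>\<omega>. \<forall>j\<in>{Suc a..k}. X j \<omega> = x j", symmetric]
      sum_distrib_left sum_distrib_right
    by (rule sum.cong[OF refl eq])
qed

text \<open>Lengthening the block from \<open>k\<close> to \<open>Suc k\<close> scales both sides by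
  the same transition factor \<open>?t k / ?s k\<close>, whether the block starts at
  \<open>m\<close> or at \<open>Suc m\<close>. For \<open>k = Suc m\<close> the two sides
  coincide.\<close>

lemma markov_chain_mult_reverse:
  assumes "markov_chain \<Omega> pr n X" and "1 \<le> m" and "Suc m \<le> k" and "k \<le> n"
  shows "scheme_prob \<Omega> pr (\<lambda>\<omega>. \<forall>j\<in>{m..k}. X j \<omega> = x j) *
           scheme_prob \<Omega> pr (\<lambda>\<omega>. X (Suc m) \<omega> = x (Suc m)) =
         scheme_prob \<Omega> pr (\<lambda>\<omega>. X m \<omega> = x m \<and> X (Suc m) \<omega> = x (Suc m)) *
           scheme_prob \<Omega> pr (\<lambda>\<omega>. \<forall>j\<in>{Suc m..k}. X j \<omega> = x j)"
  using assms(3,4)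
proof (induction k rule: dec_induct)
  case base
  then show ?case
    by (simp add: atLeastAtMostSuc_conv conj_commute)
next
  case (step k)
  let ?p = "\<lambda>a b. scheme_prob \<Omega> pr (\<lambda>\<omega>. \<forall>j\<in>{a..b}. X j \<omega> = x j)"
  let ?s = "\<lambda>a. scheme_prob \<Omega> pr (\<lambda>\<omega>. X a \<omega> = x a)"
  let ?t = "\<lambda>a. scheme_prob \<Omega> pr (\<lambda>\<omega>. X a \<omega> = x a \<and> X (Suc a) \<omega> = x (Suc a))"
  have IH: "?p m k * ?s (Suc m) = ?t m * ?p (Suc m) k"
    using step by simp
  have M: "?p m (Suc k) * ?s k = ?t k * ?p m k"
      "?p (Suc m) (Suc k) * ?s k = ?t k * ?p (Suc m) k"
    using step assms(2) by (intro markov_chain_mult_from[OF assms(1)]; simp)+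
  show ?case
  \<comment> \<open>The factor \<open>?s k\<close> can be cancelled unless it is zero; in that case
    both blocks ending at \<open>Suc k\<close> are null, as they contain the index
    \<open>k\<close>.\<close>
  proof (cases "?s k = 0")
    case True
    then have "?p m (Suc k) = 0" "?p (Suc m) (Suc k) = 0"
      unfolding scheme_prob_eq_0_iff using step by force+
    then show ?thesis by simp
  next
    case False
    have "(?p m (Suc k) * ?s (Suc m)) * ?s k = (?t m * ?p (Suc m) (Suc k)) * ?s k"
      using IH M by algebra
    then show ?thesis
      using False by simp
  qed
qed

end

theorem mainTheorem5:
  fixes \<Omega> :: "'a set" and pr :: "'a \<Rightarrow> real" and n :: nat and X :: "nat \<Rightarrow> 'a \<Rightarrow> 'b"
  assumes "prob_scheme \<Omega> pr"
    and "2 \<le> n"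
    and "markov_chain \<Omega> pr n X"
  shows "markov_chain \<Omega> pr n (\<lambda>i. X (n + 1 - i))"
  unfolding markov_chain_def
proof (intro conjI ballI allI impI)
  fix i and x :: "nat \<Rightarrow> 'b"
  assume i: "i \<in> {2..n}" and ex: "\<exists>\<omega>\<in>\<Omega>. \<forall>j\<in>{1..i}. X (n + 1 - j) \<omega> = x j"
  \<comment> \<open>The \<open>i\<close>-th variable of the reversed sequence is \<open>X m\<close>,
    and its predecessor there is \<open>X (Suc m)\<close>; \<open>y\<close> is the prescribed tuple
    in the original indexing.\<close>
  define m where "m = n + 1 - i"
  define y where "y = (\<lambda>j. x (n + 1 - j))"
  have m: "1 \<le> m" "Suc m \<le> n" "i = n + 1 - m" "i - 1 = n + 1 - Suc m"
    using i by (auto simp: m_def)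
  have reflect: "(\<forall>j\<in>{1..n + 1 - a}. X (n + 1 - j) \<omega> = x j) \<longleftrightarrow> (\<forall>j\<in>{a..n}. X j \<omega> = y j)"
    if "1 \<le> a" "a \<le> n" for a \<omega>
  proof -
    have "{a..n} = (\<lambda>j. n + 1 - j) ` {1..n + 1 - a}"
    proof (intro equalityI subsetI)
      fix j assume "j \<in> {a..n}"
      then show "j \<in> (\<lambda>j. n + 1 - j) ` {1..n + 1 - a}"
        using that by (intro image_eqI[of _ _ "n + 1 - j"]) auto
    qed (use that in auto)
    then show ?thesis
      by (auto simp: y_def)
  qed
  let ?Q = "\<lambda>\<omega>. \<forall>j\<in>{Suc m..n}. X j \<omega> = y j"
  have Q: "(X m \<omega> = y m \<and> ?Q \<omega>) \<longleftrightarrow> (\<forall>j\<in>{m..n}. X j \<omega> = y j)" for \<omega>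
    using atLeastAtMost_insertL[of m n] m(2) by auto
  have "\<exists>\<omega>\<in>\<Omega>. \<forall>j\<in>{m..n}. X j \<omega> = y j"
    using ex reflect[of m] m by simp
  \<comment> \<open>The prescribed tuple is attained, so both conditioning events are nonempty and
    the quotients may be cross-multiplied.\<close>
  then have pos: "0 < scheme_prob \<Omega> pr ?Q" "0 < scheme_prob \<Omega> pr (\<lambda>\<omega>. X (Suc m) \<omega> = y (Suc m))"
    unfolding scheme_prob_pos_iff[OF assms(1)] using m(2) by force+
  have "cond_prob (scheme_measure \<Omega> pr) (\<lambda>\<omega>. X m \<omega> = y m) ?Q =
      cond_prob (scheme_measure \<Omega> pr) (\<lambda>\<omega>. X m \<omega> = y m) (\<lambda>\<omega>. X (Suc m) \<omega> = y (Suc m))"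
    using markov_chain_mult_reverse[OF assms(1,3) m(1,2) order_refl, of y] pos
    by (simp add: cond_prob_scheme_measure[OF assms(1)] frac_eq_eq Q)
  moreover have "n + 1 - i = m" "n + 1 - (i - 1) = Suc m" "x i = y m" "x (i - 1) = y (Suc m)"
    using i by (auto simp: m_def y_def)
  moreover have "(\<lambda>\<omega>. \<forall>j\<in>{1..i - 1}. X (n + 1 - j) \<omega> = x j) = ?Q"
    using reflect[of "Suc m"] m by simp
  ultimately show "cond_prob (scheme_measure \<Omega> pr) (\<lambda>\<omega>. X (n + 1 - i) \<omega> = x i)
        (\<lambda>\<omega>. \<forall>j\<in>{1..i - 1}. X (n + 1 - j) \<omega> = x j) =
      cond_prob (scheme_measure \<Omega> pr) (\<lambda>\<omega>. X (n + 1 - i) \<omega> = x i)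
        (\<lambda>\<omega>. X (n + 1 - (i - 1)) \<omega> = x (i - 1))"
    by simp
qed (use assms(2) in simp)

end
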